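(* Let $\|\cdot\|$ be a norm on $\mathbb{R}^m$ with dual norm $\|\cdot\|_*$, $\Xi=\mathbb{R}^m$, $\widehat\xi_1,\dots,\widehat\xi_N\in\mathbb{R}^m$, $\widehat{\mathbb P}_N=\frac1N\sum_{i=1}^N\delta_{\widehat\xi_i}$, $\varepsilon\ge0$ and $\alpha\in[0,1)$. Let $\ell:\mathbb{R}^m\to\mathbb{R}$ be a convex function with $$L:=\sup_{x\in\mathbb{R}^m}\|\partial\ell(x)\|_*<\infty .$$ Then the CVaR-Wasserstein worst-case expectation satisfies $$\sup_{\mathbb P\in\mathbb{B}^{\alpha}_{(1),\varepsilon}(\widehat{\mathbb P}_N)}\mathbb{E}^{\mathbb P}[\ell(\xi)]=\max\Big\{\sup_{\mathbb P\in\mathbb{B}^{\rm wc}_{\varepsilon}(\widehat{\mathbb P}_N)}\mathbb{E}^{\mathbb P}[\ell(\xi)],\ \sup_{\mathbb P\in\mathbb{B}^{\rm W}_{(1-\alpha)\varepsilon}(\widehat{\mathbb P}_N)}\mathbb{E}^{\mathbb P}[\ell(\xi)]\Big\},$$ where $$\sup_{\mathbb P\in\mathbb{B}^{\rm wc}_{\varepsilon}(\widehat{\mathbb P}_N)}\mathbb{E}^{\mathbb P}[\ell(\xi)]=\frac1N\sum_{i=1}^N\max_{e:\|e\|=1}\ell(\widehat\xi_i+\varepsilon e)$$ and $$\sup_{\mathbb P\in\mathbb{B}^{\rm W}_{(1-\alpha)\varepsilon}(\widehat{\mathbb P}_N)}\mathbb{E}^{\mathbb P}[\ell(\xi)]=\frac1N\sum_{i=1}^N\ell(\widehat\xi_i)+L(1-\alpha)\varepsilon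 .$$
   Context: $\|\partial\ell(x)\|_*$ denotes the largest dual norm of a subgradient of $\ell$ at $x$, so $L=\sup\{\|g\|_*: x\in\mathbb{R}^m,\ g\in\partial\ell(x)\}$. For a functional $\rho$ of nonnegative random variables depending only on the law, set $d_\rho(\mathbb P_1,\mathbb P_2)=\inf_\Pi\rho^{\Pi}(\|\xi_1-\xi_2\|)$, the infimum over joint distributions $\Pi$ of $(\xi_1,\xi_2)$ with marginals $\mathbb P_1,\mathbb P_2$. With $\mathcal M(\Xi)$ the set of probability distributions supported on $\Xi$, define the balls $\{\mathbb P\in\mathcal M(\Xi): d_\rho(\widehat{\mathbb P}_N,\mathbb P)\le r\}$: this is $\mathbb{B}^{\rm W}_{r}(\widehat{\mathbb P}_N)$ for $\rho=\mathbb{E}$ (type-1 Wasserstein), $\mathbb{B}^{\rm wc}_{r}(\widehat{\mathbb P}_N)$ for $\rho=\operatorname{ess\,sup}$ (type-$\infty$ Wasserstein), and $\mathbb{B}^{\alpha}_{(1),r}(\widehat{\mathbb P}_N)$ for $\rho={\rm CVaR}_\alpha$, where ${\rm CVaR}_\alpha(X)=\frac1{1-\alpha}\int_\alpha^1{\rm VaR}_u(X)\,du$ and ${\rm VaR}_u(X)=\inf\{x:\mathbb{P}(X\le x)\ge u\}$. *)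

theory Defs
  imports "HOL-Probability.Probability"
begin

definition is_norm :: "(real ^ 'n \<Rightarrow> real) \<Rightarrow> bool" where
  "is_norm nrm \<longleftrightarrow>
     (\<forall>x. nrm x = 0 \<longleftrightarrow> x = 0) \<and>
     (\<forall>c x. nrm (c *\<^sub>R x) = \<bar>c\<bar> * nrm x) \<and>
     (\<forall>x y. nrm (x + y) \<le> nrm x + nrm y)"

text \<open>The supremum is over a bounded nonempty set whenever \<open>nrm\<close> is a norm.\<close>

definition dual_norm :: "(real ^ 'n \<Rightarrow> real) \<Rightarrow> real ^ 'n \<Rightarrow> real" where
  "dual_norm nrm g = (SUP x\<in>{x. nrm x \<le> 1}. g \<bullet> x)"

definition subdifferential :: "(real ^ 'n \<Rightarrow> real) \<Rightarrow> real ^ 'n \<Rightarrow> (real ^ 'n) set" where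
  "subdifferential l x = {g. \<forall>y. l y \<ge> l x + g \<bullet> (y - x)}"

definition max_subgradient_norm :: "(real ^ 'n \<Rightarrow> real) \<Rightarrow> (real ^ 'n \<Rightarrow> real) \<Rightarrow> ereal" where
  "max_subgradient_norm nrm l = (SUP x. SUP g\<in>subdifferential l x. ereal (dual_norm nrm g))"

definition prob_dists :: "(real ^ 'n) measure set" where
  "prob_dists = {P. prob_space P \<and> sets P = sets borel}"

definition empirical :: "nat \<Rightarrow> (nat \<Rightarrow> real ^ 'n) \<Rightarrow> (real ^ 'n) measure" where
  "empirical N xi = distr (uniform_count_measure {1..N}) borel xi"

lemma emeasure_empirical:
  assumes "N \<ge> 1" "A \<in> sets borel"
  shows "emeasure (empirical N xi) A =
    (\<Sum>i=1..N. emeasure (return borel (xi i)) A) / of_nat N"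
proof -
  have m: "xi \<in> uniform_count_measure {1..N} \<rightarrow>\<^sub>M borel"
    by (simp add: measurable_def space_uniform_count_measure sets_uniform_count_measure)
  have "emeasure (empirical N xi) A = ennreal (real (card (xi -` A \<inter> {1..N})) / real N)"
    using assms m
    by (simp add: empirical_def emeasure_distr space_uniform_count_measure
        emeasure_uniform_count_measure)
  also have "real (card (xi -` A \<inter> {1..N})) = (\<Sum>i=1..N. indicator A (xi i))"
    by (simp add: indicator_def Collect_conj_eq vimage_def Int_commute)
  also have "ennreal ((\<Sum>i=1..N. indicator A (xi i)) / real N) =
      (\<Sum>i=1..N. ennreal (indicator A (xi i))) / of_nat N"
    using assms by (simp add: divide_ennreal[symmetric] sum_nonneg ennreal_of_nat_eq_real_of_nat)
  finally show ?thesis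
    using assms by (simp add: ennreal_indicator)
qed

definition couplings ::
  "(real ^ 'n) measure \<Rightarrow> (real ^ 'n) measure \<Rightarrow> ((real ^ 'n) \<times> (real ^ 'n)) measure set" where
  "couplings P1 P2 =
     {Q. prob_space Q \<and> sets Q = sets (borel \<Otimes>\<^sub>M borel) \<and>
         distr Q borel fst = P1 \<and> distr Q borel snd = P2}"

text \<open>A functional of nonnegative random variables takes the underlying probability space and
  the random variable, and may be infinite.\<close>

type_synonym 'a functional = "'a measure \<Rightarrow> ('a \<Rightarrow> real) \<Rightarrow> ennreal"

definition mean :: "'a functional" where
  "mean M X = (\<integral>\<^sup>+ w. ennreal (X w) \<partial>M)"

definition ess_sup :: "'a functional" where
  "ess_sup M X = esssup M (\<lambda>w. ennreal (X w))"

definition VaR :: "real \<Rightarrow> 'a measure \<Rightarrow> ('a \<Rightarrow> real) \<Rightarrow> ereal" where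
  "VaR u M X = Inf {ereal x | x. measure M {w \<in> space M. X w \<le> x} \<ge> u}"

text \<open>For nonnegative \<open>X\<close> the integrand is nonnegative except that \<open>VaR 0 M X = -\<infinity>\<close>, at a single
  point, so the truncation at \<open>0\<close> made by \<open>e2ennreal\<close> does not change the integral.\<close>

definition CVaR :: "real \<Rightarrow> 'a functional" where
  "CVaR \<alpha> M X =
     ennreal (1 / (1 - \<alpha>)) * (\<integral>\<^sup>+ u\<in>{\<alpha>..1}. e2ennreal (VaR u M X) \<partial>lborel)"

definition transport_dist ::
  "(real ^ 'n \<Rightarrow> real) \<Rightarrow> ((real ^ 'n) \<times> (real ^ 'n)) functional \<Rightarrow>
   (real ^ 'n) measure \<Rightarrow> (real ^ 'n) measure \<Rightarrow> ennreal" where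
  "transport_dist nrm \<rho> P1 P2 =
     (INF Q\<in>couplings P1 P2. \<rho> Q (\<lambda>(x, y). nrm (x - y)))"

definition transport_ball ::
  "(real ^ 'n \<Rightarrow> real) \<Rightarrow> ((real ^ 'n) \<times> (real ^ 'n)) functional \<Rightarrow>
   real \<Rightarrow> (real ^ 'n) measure \<Rightarrow> (real ^ 'n) measure set" where
  "transport_ball nrm \<rho> r P0 = {P \<in> prob_dists. transport_dist nrm \<rho> P0 P \<le> ennreal r}"

abbreviation ball_W ::
  "(real ^ 'n \<Rightarrow> real) \<Rightarrow> real \<Rightarrow> (real ^ 'n) measure \<Rightarrow> (real ^ 'n) measure set" where
  "ball_W nrm \<equiv> transport_ball nrm mean"

abbreviation ball_wc ::
  "(real ^ 'n \<Rightarrow> real) \<Rightarrow> real \<Rightarrow> (real ^ 'n) measure \<Rightarrow> (real ^ 'n) measure set" where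
  "ball_wc nrm \<equiv> transport_ball nrm ess_sup"

abbreviation ball_CVaR ::
  "(real ^ 'n \<Rightarrow> real) \<Rightarrow> real \<Rightarrow> real \<Rightarrow> (real ^ 'n) measure \<Rightarrow> (real ^ 'n) measure set" where
  "ball_CVaR nrm \<alpha> \<equiv> transport_ball nrm (CVaR \<alpha>)"

text \<open>Unlike the Bochner integral, which is \<open>0\<close> on non-integrable functions, this is infinite when
  exactly one of the positive and negative parts has infinite integral. If both have, it is \<open>\<infinity>\<close>.\<close>

definition expect :: "'a measure \<Rightarrow> ('a \<Rightarrow> real) \<Rightarrow> ereal" where
  "expect P f =
     enn2ereal (\<integral>\<^sup>+ x. ennreal (f x) \<partial>P) - enn2ereal (\<integral>\<^sup>+ x. ennreal (- f x) \<partial>P)"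

lemma expect_eq_integral:
  assumes "integrable P f"
  shows "expect P f = ereal (integral\<^sup>L P f)"
proof -
  have "(\<integral>\<^sup>+ x. ennreal (f x) \<partial>P) < \<infinity>" "(\<integral>\<^sup>+ x. ennreal (- f x) \<partial>P) < \<infinity>"
    using real_integrable_def[of P f] assms by (auto simp: top.not_eq_extremum)
  then show ?thesis
    by (auto simp: expect_def real_lebesgue_integral_def[OF assms] enn2ereal_ennreal
        less_top_ennreal)
qed

definition worst_case :: "(real ^ 'n) measure set \<Rightarrow> (real ^ 'n \<Rightarrow> real) \<Rightarrow> ereal" where
  "worst_case B l = (SUP P\<in>B. expect P l)"

end

theory Submission
  imports Defs
begin

text \<open>
  Write \<open>K\<close> for the largest dual norm of a subgradient and \<open>f x t\<close> for the largest loss on the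
  sphere of radius \<open>t\<close> around \<open>x\<close> (\<open>sphere_max\<close>). Since \<open>l\<close> is convex and grows at rate at most
  \<open>K\<close>, a unit of mass that travels from \<open>x\<close> to \<open>y\<close> satisfies, for every threshold \<open>t \<ge> 0\<close>,
  \<open>l y \<le> f x t + K * max 0 (nrm (x - y) - t)\<close>. Integrating over a coupling of the empirical
  distribution with \<open>P\<close> bounds the expected loss under \<open>P\<close> by the average of \<open>f (xi i) t\<close> plus
  \<open>K\<close> times the expected excess of the transport distance over \<open>t\<close>
  (\<open>expectation_le_by_coupling\<close>).

  All three upper bounds are choices of \<open>t\<close>. In the type-infinity ball of radius \<open>\<epsilon>\<close> take
  \<open>t = \<epsilon>\<close>, so that there is no excess. In the type-1 ball take \<open>t = 0\<close>, so that the excess is the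
  whole transport cost. For CVaR take \<open>t = VaR\<^sub>\<alpha>\<close> (or \<open>t = 0\<close> if \<open>\<alpha> = 0\<close>): there CVaR equals \<open>t\<close> plus \<open>1 / (1 - \<alpha>)\<close>
  times the expected excess over \<open>t\<close> (\<open>CVaR_eq_threshold_plus_excess\<close>), so a CVaR of at most
  \<open>\<epsilon>\<close> leaves an excess of at most \<open>(1 - \<alpha>) * (\<epsilon> - t)\<close>. The resulting bound is convex in \<open>t\<close> on
  \<open>[0, \<epsilon>]\<close>, hence at most the larger of its values at the end points, and these are the other two
  worst cases (\<open>threshold_bound_le_max\<close>). As the transport distance is an infimum over couplings,
  each bound is first proved for the radius \<open>\<epsilon> + \<delta>\<close>, and then \<open>\<delta>\<close> tends to \<open>0\<close>.

  The bounds are attained or approached. Moving every atom to the worst point of its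
  sphere costs \<open>\<epsilon>\<close> in the type-infinity sense. Sending a fraction \<open>p\<close> of the mass a distance
  proportional to \<open>1 / p\<close> along a direction of nearly steepest growth turns the type-1 budget
  into a gain at a rate close to \<open>K\<close> as \<open>p\<close> tends to \<open>0\<close>. The CVaR ball contains both other balls, because CVaR is at most
  the essential supremum and at most \<open>1 / (1 - \<alpha>)\<close> times the mean.
\<close>

section \<open>Norms and their duals\<close>

lemma is_normD:
  assumes "is_norm nrm"
  shows norm_zero_iff: "nrm x = 0 \<longleftrightarrow> x = 0"
    and norm_homogeneous: "nrm (c *\<^sub>R x) = \<bar>c\<bar> * nrm x"
    and norm_subadditive: "nrm (x + y) \<le> nrm x + nrm y"
  using assms by (auto simp: is_norm_def)

lemma norm_symmetric:
  assumes "is_norm nrm"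
  shows "nrm (x - y) = nrm (y - x)"
  using norm_homogeneous[OF assms, of "-1" "y - x"] by simp

lemma norm_nonneg:
  assumes "is_norm nrm"
  shows "0 \<le> nrm x"
  using norm_subadditive[OF assms, of x "-x"] norm_zero_iff[OF assms, of 0]
    norm_symmetric[OF assms, of x 0] by simp

lemma norm_normalised:
  assumes "is_norm nrm" "x \<noteq> 0"
  shows "nrm (x /\<^sub>R nrm x) = 1"
  using norm_zero_iff[OF assms(1), of x] norm_nonneg[OF assms(1), of x] assms(2)
  by (simp add: norm_homogeneous[OF assms(1)])

lemma norm_convex:
  fixes nrm :: "real ^ 'n \<Rightarrow> real"
  assumes "is_norm nrm"
  shows "convex_on UNIV nrm"
proof (rule convex_onI)
  fix t :: real and x y :: "real ^ 'n"
  assume t: "0 < t" "t < 1"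
  show "nrm ((1 - t) *\<^sub>R x + t *\<^sub>R y) \<le> (1 - t) * nrm x + t * nrm y"
    using norm_subadditive[OF assms, of "(1 - t) *\<^sub>R x" "t *\<^sub>R y"] t
    by (simp add: norm_homogeneous[OF assms])
qed simp

lemma norm_continuous:
  assumes "is_norm nrm"
  shows "continuous_on UNIV nrm"
  using convex_on_continuous norm_convex[OF assms] by blast

text \<open>The euclidean unit sphere is compact and \<open>nrm\<close> is continuous and positive on it, so
  \<open>nrm\<close> dominates a multiple of the euclidean norm. This is what makes the unit sphere of
  \<open>nrm\<close> compact and the dual norm finite.\<close>

lemma norm_dominates_euclidean:
  fixes nrm :: "real ^ 'n \<Rightarrow> real"
  assumes "is_norm nrm"
  obtains c where "0 < c" "\<And>x. c * norm x \<le> nrm x"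
proof -
  have "\<exists>x\<in>sphere 0 1. \<forall>y\<in>sphere 0 1. nrm x \<le> nrm y"
    using vector_choose_size[of 1, where 'a="real^'n"]
    by (intro continuous_attains_inf) (auto intro: continuous_on_subset[OF norm_continuous[OF assms]])
  then obtain x0 where x0: "norm x0 = 1" "\<And>y. norm y = 1 \<Longrightarrow> nrm x0 \<le> nrm y"
    by auto
  have "0 < nrm x0"
    using norm_zero_iff[OF assms, of x0] norm_nonneg[OF assms, of x0] x0(1) by auto
  moreover have "nrm x0 * norm x \<le> nrm x" for x
  proof (cases "x = 0")
    case False
    then have "nrm x0 \<le> nrm (x /\<^sub>R norm x)"
      by (intro x0(2)) simp
    then show ?thesis
      using False by (simp add: norm_homogeneous[OF assms] field_simps)
  qed (use norm_nonneg[OF assms] in auto)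
  ultimately show ?thesis
    using that by blast
qed

lemma unit_sphere_compact_nonempty:
  fixes nrm :: "real ^ 'n \<Rightarrow> real"
  assumes "is_norm nrm"
  shows "compact {e. nrm e = 1}" "{e. nrm e = 1} \<noteq> {}"
proof -
  obtain c where c: "0 < c" "\<And>x. c * norm x \<le> nrm x"
    using norm_dominates_euclidean[OF assms] by blast
  have "norm e \<le> 1 / c" if "nrm e = 1" for e
    using c(2)[of e] c(1) that by (simp add: field_simps)
  then have "bounded {e. nrm e = 1}"
    by (auto simp: bounded_iff)
  moreover have "closed {e. nrm e = 1}"
    using continuous_closed_preimage_constant[OF norm_continuous[OF assms], of 1] by simp
  ultimately show "compact {e. nrm e = 1}"
    by (simp add: compact_eq_bounded_closed)
  obtain x :: "real ^ 'n" where "x \<noteq> 0"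
    using vector_choose_size[of 1, where 'a="real^'n"] by force
  then show "{e. nrm e = 1} \<noteq> {}"
    using norm_normalised[OF assms] by blast
qed

lemma bdd_above_dual_norm:
  assumes "is_norm nrm"
  shows "bdd_above ((\<lambda>x. g \<bullet> x) ` {x. nrm x \<le> 1})"
proof -
  obtain c where c: "0 < c" "\<And>x. c * norm x \<le> nrm x"
    using norm_dominates_euclidean[OF assms] by blast
  have "g \<bullet> x \<le> norm g * (1 / c)" if "nrm x \<le> 1" for x
  proof -
    have "norm x \<le> 1 / c"
      using c(2)[of x] c(1) that by (simp add: field_simps)
    then show ?thesis
      using norm_cauchy_schwarz[of g x] mult_left_mono[of "norm x" "1 / c" "norm g"] by simp
  qed
  then show ?thesis
    by (auto simp: bdd_above_def)
qed

lemma inner_le_dual_norm: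
  assumes "is_norm nrm"
  shows "g \<bullet> x \<le> dual_norm nrm g * nrm x"
proof (cases "x = 0")
  case False
  then have "0 < nrm x"
    using norm_zero_iff[OF assms, of x] norm_nonneg[OF assms, of x] by auto
  moreover have "g \<bullet> (x /\<^sub>R nrm x) \<le> dual_norm nrm g"
    unfolding dual_norm_def using norm_normalised[OF assms False]
    by (intro cSUP_upper bdd_above_dual_norm[OF assms]) auto
  ultimately show ?thesis
    by (simp add: field_simps)
qed (use norm_zero_iff[OF assms, of 0] in simp)

section \<open>Convex functions with bounded subgradients\<close>

text \<open>The strict epigraph is convex and misses the point \<open>(x, l x)\<close>. A hyperplane separating
  the two cannot be vertical, because the epigraph projects onto the whole space, so after
  rescaling it is the graph of an affine minorant of \<open>l\<close> that touches \<open>l\<close> at \<open>x\<close>.\<close>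

lemma subdifferential_nonempty:
  fixes l :: "real ^ 'n \<Rightarrow> real"
  assumes l: "convex_on UNIV l"
  obtains g where "g \<in> subdifferential l x"
proof -
  define S where "S = {(y, s). l y < s}"
  have "convex S"
  proof (rule convexI)
    fix a b :: "(real ^ 'n) \<times> real" and u v :: real
    assume a: "a \<in> S" "b \<in> S" "0 \<le> u" "0 \<le> v" "u + v = 1"
    obtain y s z t where [simp]: "a = (y, s)" "b = (z, t)"
      by (cases a, cases b)
    have "l (u *\<^sub>R y + v *\<^sub>R z) \<le> u * l y + v * l z"
      using l a by (simp add: convex_on_def)
    also have "\<dots> < u * s + v * t"
    proof (cases "u = 0")
      case False
      then have "u * l y < u * s" "v * l z \<le> v * t"
        using a by (auto simp: S_def intro: mult_left_mono)
      then show ?thesis by simp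
    qed (use a in \<open>auto simp: S_def\<close>)
    finally show "u *\<^sub>R a + v *\<^sub>R b \<in> S"
      by (simp add: S_def)
  qed
  moreover have "S \<noteq> {}"
    using gt_ex[of "l x"] by (auto simp: S_def)
  moreover have "S \<inter> {(x, l x)} = {}"
    by (auto simp: S_def)
  ultimately obtain a b where ab: "a \<noteq> 0" "\<forall>p\<in>S. a \<bullet> p \<le> b" "a \<bullet> (x, l x) \<ge> b"
    using separating_hyperplane_sets[of S "{(x, l x)}"] by auto
  obtain g c where a: "a = (g, c)"
    by (cases a)
  have sep: "g \<bullet> y + c * s \<le> g \<bullet> x + c * l x" if "l y < s" for y s
    using ab(2)[rule_format, of "(y, s)"] ab(3) that by (simp add: a S_def)
  have "c < 0"
  proof (rule ccontr)
    assume "\<not> c < 0"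
    moreover have "c \<le> 0"
      using sep[of x "l x + 1"] by (simp add: algebra_simps)
    ultimately have "c = 0"
      by simp
    \<comment> \<open>A vertical hyperplane would bound \<open>g \<bullet> y\<close> by \<open>g \<bullet> x\<close> for every \<open>y\<close>, and \<open>y = x + g\<close> violates this.\<close>
    then have "g \<bullet> g \<le> 0"
      using sep[of "x + g" "l (x + g) + 1"] by (simp add: algebra_simps)
    then have "g = 0"
      using inner_gt_zero_iff[of g] by linarith
    then show False
      using ab(1) a \<open>c = 0\<close> by (simp add: zero_prod_def)
  qed
  have "l x + (g /\<^sub>R (-c)) \<bullet> (y - x) \<le> l y" for y
  proof (rule field_le_epsilon)
    fix d :: real assume "0 < d"
    then have "g \<bullet> y + c * (l y + d) \<le> g \<bullet> x + c * l x"
      by (intro sep) simp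
    then show "l x + (g /\<^sub>R (-c)) \<bullet> (y - x) \<le> l y + d"
      using \<open>c < 0\<close> by (simp add: field_simps inner_diff_right)
  qed
  then show ?thesis
    using that[of "g /\<^sub>R (-c)"] by (simp add: subdifferential_def)
qed

lemma max_subgradient_norm_ereal:
  fixes l :: "real ^ 'n \<Rightarrow> real"
  assumes "is_norm nrm" "convex_on UNIV l" "max_subgradient_norm nrm l < \<infinity>"
  obtains K where "0 \<le> K" "max_subgradient_norm nrm l = ereal K"
proof -
  obtain g where g: "g \<in> subdifferential l 0"
    using subdifferential_nonempty[OF assms(2)] by blast
  have "0 = g \<bullet> 0"
    by simp
  also have "\<dots> \<le> dual_norm nrm g"
    unfolding dual_norm_def using norm_zero_iff[OF assms(1), of 0]
    by (intro cSUP_upper bdd_above_dual_norm[OF assms(1)]) auto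
  finally have "0 \<le> ereal (dual_norm nrm g)"
    by simp
  also have "\<dots> \<le> max_subgradient_norm nrm l"
    unfolding max_subgradient_norm_def using g by (intro SUP_upper2[of 0] SUP_upper) auto
  finally show ?thesis
    using assms(3) that by (cases "max_subgradient_norm nrm l") auto
qed

lemma dual_norm_le_max_subgradient_norm:
  assumes "max_subgradient_norm nrm l = ereal K" "g \<in> subdifferential l x"
  shows "dual_norm nrm g \<le> K"
proof -
  have "ereal (dual_norm nrm g) \<le> max_subgradient_norm nrm l"
    unfolding max_subgradient_norm_def using assms(2) by (intro SUP_upper2[of x] SUP_upper) auto
  then show ?thesis
    using assms(1) by simp
qed

text \<open>A subgradient at the end point \<open>y\<close> bounds the increase of \<open>l\<close> from \<open>x\<close> to \<open>y\<close> from above,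
  whereas one at \<open>x\<close> would bound it from below.\<close>

lemma convex_lipschitz:
  assumes "is_norm nrm" "convex_on UNIV l" "max_subgradient_norm nrm l = ereal K"
  shows "l y \<le> l x + K * nrm (x - y)"
proof -
  obtain g where g: "g \<in> subdifferential l y"
    using subdifferential_nonempty[OF assms(2)] by blast
  then have "l y + g \<bullet> (x - y) \<le> l x"
    by (simp add: subdifferential_def)
  then have "l y \<le> l x + g \<bullet> (y - x)"
    by (simp add: inner_diff_right)
  also have "g \<bullet> (y - x) \<le> dual_norm nrm g * nrm (y - x)"
    by (rule inner_le_dual_norm[OF assms(1)])
  also have "\<dots> \<le> K * nrm (y - x)"
    using dual_norm_le_max_subgradient_norm[OF assms(3) g] norm_nonneg[OF assms(1)]
    by (intro mult_right_mono)
  finally show ?thesis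
    by (simp add: norm_symmetric[OF assms(1)])
qed

text \<open>An affine minorant with such a slope \<open>g\<close> forces \<open>l\<close>, from every starting point, to grow along
  the ray in direction \<open>d\<close> at an asymptotic rate above \<open>c\<close>, for any \<open>c < K\<close>.\<close>

lemma steep_direction:
  assumes "is_norm nrm" "max_subgradient_norm nrm l = ereal K" "c < K"
  obtains x g d where "g \<in> subdifferential l x" "nrm d \<le> 1" "c < g \<bullet> d"
proof -
  have "ereal c < max_subgradient_norm nrm l"
    using assms by simp
  then obtain x g where g: "g \<in> subdifferential l x" "c < dual_norm nrm g"
    unfolding max_subgradient_norm_def by (auto simp: less_SUP_iff)
  have "{x. nrm x \<le> 1} \<noteq> {}"
    using norm_zero_iff[OF assms(1), of 0] by (metis empty_iff mem_Collect_eq zero_le_one)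
  then obtain d where "nrm d \<le> 1" "c < g \<bullet> d"
    using g(2) bdd_above_dual_norm[OF assms(1)] unfolding dual_norm_def
    by (auto simp: less_cSUP_iff)
  then show ?thesis
    using that g by blast
qed

section \<open>The largest loss on a sphere\<close>

definition sphere_max :: "(real ^ 'n \<Rightarrow> real) \<Rightarrow> (real ^ 'n \<Rightarrow> real) \<Rightarrow> real ^ 'n \<Rightarrow> real \<Rightarrow> real" where
  "sphere_max nrm l x t = (SUP e\<in>{e. nrm e = 1}. l (x + t *\<^sub>R e))"

lemma sphere_max_attained:
  assumes "is_norm nrm" "convex_on UNIV l"
  obtains e where "nrm e = 1" "\<And>e'. nrm e' = 1 \<Longrightarrow> l (x + t *\<^sub>R e') \<le> l (x + t *\<^sub>R e)"
    "sphere_max nrm l x t = l (x + t *\<^sub>R e)"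
proof -
  have "continuous_on UNIV l"
    using convex_on_continuous assms(2) by blast
  then have "continuous_on {e. nrm e = 1} (\<lambda>e. l (x + t *\<^sub>R e))"
    by (rule continuous_on_compose2[where f="\<lambda>e. x + t *\<^sub>R e"])
      (intro continuous_intros, simp)
  then obtain e where e: "nrm e = 1" "\<And>e'. nrm e' = 1 \<Longrightarrow> l (x + t *\<^sub>R e') \<le> l (x + t *\<^sub>R e)"
    using continuous_attains_sup[OF unit_sphere_compact_nonempty[OF assms(1)]] by blast
  moreover have "sphere_max nrm l x t = l (x + t *\<^sub>R e)"
    unfolding sphere_max_def using e by (intro cSup_eq_maximum) auto
  ultimately show ?thesis
    using that by blast
qed

lemma le_sphere_max:
  assumes "is_norm nrm" "convex_on UNIV l" "nrm e = 1"
  shows "l (x + t *\<^sub>R e) \<le> sphere_max nrm l x t"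
proof -
  obtain e0 where "\<And>e'. nrm e' = 1 \<Longrightarrow> l (x + t *\<^sub>R e') \<le> l (x + t *\<^sub>R e0)"
    "sphere_max nrm l x t = l (x + t *\<^sub>R e0)"
    using sphere_max_attained[OF assms(1,2)] by blast
  then show ?thesis
    using assms(3) by simp
qed

lemma sphere_max_leI:
  assumes "is_norm nrm" "convex_on UNIV l" "\<And>e. nrm e = 1 \<Longrightarrow> l (x + t *\<^sub>R e) \<le> b"
  shows "sphere_max nrm l x t \<le> b"
proof -
  obtain e0 where "nrm e0 = 1" "sphere_max nrm l x t = l (x + t *\<^sub>R e0)"
    using sphere_max_attained[OF assms(1,2)] by blast
  then show ?thesis
    using assms(3) by simp
qed

lemma sphere_max_radius_zero:
  assumes "is_norm nrm" "convex_on UNIV l"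
  shows "sphere_max nrm l x 0 = l x"
proof -
  obtain e where "sphere_max nrm l x 0 = l (x + 0 *\<^sub>R e)"
    using sphere_max_attained[OF assms] by blast
  then show ?thesis
    by simp
qed

lemma sphere_max_lipschitz_radius:
  assumes "is_norm nrm" "convex_on UNIV l" "max_subgradient_norm nrm l = ereal K" "s \<le> t"
  shows "sphere_max nrm l x t \<le> sphere_max nrm l x s + K * (t - s)"
proof (rule sphere_max_leI[OF assms(1,2)])
  fix e assume e: "nrm e = 1"
  have "l (x + t *\<^sub>R e) \<le> l (x + s *\<^sub>R e) + K * nrm ((x + s *\<^sub>R e) - (x + t *\<^sub>R e))"
    by (rule convex_lipschitz[OF assms(1-3)])
  also have "(x + s *\<^sub>R e) - (x + t *\<^sub>R e) = (s - t) *\<^sub>R e"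
    by (simp add: algebra_simps)
  also have "nrm \<dots> = t - s"
    using e assms(4) by (simp add: norm_homogeneous[OF assms(1)])
  finally show "l (x + t *\<^sub>R e) \<le> sphere_max nrm l x s + K * (t - s)"
    using le_sphere_max[OF assms(1,2) e, of x s] by simp
qed

text \<open>For each fixed \<open>e\<close> the value \<open>l (x + t *\<^sub>R e)\<close> is convex in the pair \<open>(x, t)\<close>, and suprema
  preserve this. Convexity in \<open>x\<close> alone gives measurability, convexity in \<open>t\<close> alone the
  comparison of the CVaR bound with its two end points.\<close>

lemma sphere_max_convex:
  assumes "is_norm nrm" "convex_on UNIV l" "0 \<le> u" "0 \<le> v" "u + v = 1"
  shows "sphere_max nrm l (u *\<^sub>R x + v *\<^sub>R y) (u * s + v * t)
      \<le> u * sphere_max nrm l x s + v * sphere_max nrm l y t"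
proof (rule sphere_max_leI[OF assms(1,2)])
  fix e assume e: "nrm e = 1"
  have "u *\<^sub>R x + v *\<^sub>R y + (u * s + v * t) *\<^sub>R e = u *\<^sub>R (x + s *\<^sub>R e) + v *\<^sub>R (y + t *\<^sub>R e)"
    by (simp add: algebra_simps)
  also have "l \<dots> \<le> u * l (x + s *\<^sub>R e) + v * l (y + t *\<^sub>R e)"
    using assms by (simp add: convex_on_def)
  also have "\<dots> \<le> u * sphere_max nrm l x s + v * sphere_max nrm l y t"
    using assms e by (intro add_mono mult_left_mono le_sphere_max) auto
  finally show "l (u *\<^sub>R x + v *\<^sub>R y + (u * s + v * t) *\<^sub>R e)
      \<le> u * sphere_max nrm l x s + v * sphere_max nrm l y t" .
qed

lemma sphere_max_measurable:
  assumes "is_norm nrm" "convex_on UNIV l"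
  shows "(\<lambda>x. sphere_max nrm l x t) \<in> borel_measurable borel"
proof -
  have "convex_on UNIV (\<lambda>x. sphere_max nrm l x t)"
    using sphere_max_convex[OF assms, where s=t and t=t]
    by (auto simp: convex_on_def distrib_right[symmetric])
  then show ?thesis
    using convex_on_continuous borel_measurable_continuous_onI by blast
qed

text \<open>Inside the ball of radius \<open>t\<close> a point lies on a chord between two antipodal points of
  the sphere, so convexity bounds \<open>l\<close> there by its maximum on the sphere. Outside, the
  Lipschitz bound pays for the excess distance only.\<close>

lemma le_sphere_max_plus_excess:
  assumes "is_norm nrm" "convex_on UNIV l" "max_subgradient_norm nrm l = ereal K" "0 \<le> t"
  shows "l y \<le> sphere_max nrm l x t + K * max 0 (nrm (x - y) - t)"
proof -
  define s where "s = nrm (y - x)"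
  have "0 \<le> s"
    using norm_nonneg[OF assms(1)] by (simp add: s_def)
  obtain e where e: "nrm e = 1" "y = x + s *\<^sub>R e"
  proof (cases "y = x")
    case True
    then have "s = 0"
      using norm_zero_iff[OF assms(1), of 0] by (simp add: s_def)
    then show ?thesis
      using that unit_sphere_compact_nonempty[OF assms(1)] True by auto
  next
    case False
    then have "s \<noteq> 0"
      using norm_zero_iff[OF assms(1), of "y - x"] by (simp add: s_def)
    then show ?thesis
      using that[of "(y - x) /\<^sub>R s"] norm_normalised[OF assms(1), of "y - x"] False
      by (simp add: s_def)
  qed
  have "nrm (-e) = 1"
    using norm_symmetric[OF assms(1), of 0 e] e by simp
  show ?thesis
  proof (cases "s \<le> t")
    case True
    \<comment> \<open>The point at signed distance \<open>s\<close> on the chord from \<open>-t\<close> to \<open>t\<close>. For \<open>t = 0\<close> the quotient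
      is \<open>0\<close> by convention, and then \<open>s = 0\<close> as well.\<close>
    define u where "u = (1 + s / t) / 2"
    have "0 \<le> s / t" "s / t \<le> 1" "s / t * t = s"
      using True \<open>0 \<le> s\<close> assms(4) by (auto simp: divide_le_eq)
    then have u: "0 \<le> u" "0 \<le> 1 - u" "u * t - (1 - u) * t = s"
      by (simp_all add: u_def algebra_simps)
    have "u *\<^sub>R (x + t *\<^sub>R e) + (1 - u) *\<^sub>R (x + t *\<^sub>R (-e)) = x + (u * t - (1 - u) * t) *\<^sub>R e"
      by (simp add: vec_eq_iff algebra_simps)
    then have "l y = l (u *\<^sub>R (x + t *\<^sub>R e) + (1 - u) *\<^sub>R (x + t *\<^sub>R (-e)))"
      using u e by simp
    also have "\<dots> \<le> u * l (x + t *\<^sub>R e) + (1 - u) * l (x + t *\<^sub>R (-e))"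
      using assms(2) u unfolding convex_on_def by auto
    also have "\<dots> \<le> u * sphere_max nrm l x t + (1 - u) * sphere_max nrm l x t"
      using u e \<open>nrm (-e) = 1\<close> by (intro add_mono mult_left_mono le_sphere_max assms(1,2)) auto
    finally show ?thesis
      using True by (simp add: s_def norm_symmetric[OF assms(1), of x y] algebra_simps)
  next
    case False
    have "l y \<le> sphere_max nrm l x s"
      using le_sphere_max[OF assms(1,2) e(1), of x s] e by simp
    also have "\<dots> \<le> sphere_max nrm l x t + K * (s - t)"
      using False by (intro sphere_max_lipschitz_radius assms(1-3)) simp
    finally show ?thesis
      using False by (simp add: s_def norm_symmetric[OF assms(1), of x y])
  qed
qed

section \<open>Conditional value-at-risk as a shortfall\<close>

text \<open>The quantile function pushes the uniform distribution on \<open>(0, 1)\<close> forward to the law of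
  \<open>X\<close>. Setting it to \<open>0\<close> outside that interval makes it measurable on the whole line and a valid
  threshold at level \<open>0\<close>.\<close>

lemma quantile_function:
  assumes "prob_space M" and X[measurable]: "X \<in> borel_measurable M"
    and nonneg: "\<And>w. w \<in> space M \<Longrightarrow> 0 \<le> X w"
  obtains q :: "real \<Rightarrow> real" where
    "q \<in> borel_measurable borel" "\<And>u. 0 \<le> q u" "q 0 = 0" "mono_on {0<..<1} q"
    "\<And>u. 0 < u \<Longrightarrow> u < 1 \<Longrightarrow> VaR u M X = ereal (q u)"
    "\<And>g :: real \<Rightarrow> ennreal. g \<in> borel_measurable borel \<Longrightarrow>
       (\<integral>\<^sup>+ w. g (X w) \<partial>M) = (\<integral>\<^sup>+ u\<in>{0<..<1}. g (q u) \<partial>lborel)"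
proof -
  interpret prob_space M by fact
  interpret D: cdf_distribution "distr M borel X"
    unfolding cdf_distribution_def by (rule real_distribution_distr[OF X])
  have cdf: "D.C x = measure M {w \<in> space M. X w \<le> x}" for x
    by (auto simp: cdf_def measure_distr intro!: arg_cong[where f = "measure M"])
  define q where "q u = indicator {0<..<1} u *\<^sub>R D.I u" for u
  have q: "q u = D.I u" if "0 < u" "u < 1" for u
    using that by (simp add: q_def)
  have I: "D.I u \<le> x \<longleftrightarrow> u \<le> D.C x" if "0 < u" "u < 1" for u x
    using D.pseudoinverse[of u x] that by simp
  have "D.C x \<le> 0" if "x < 0" for x
  proof -
    have "{w \<in> space M. X w \<le> x} = {}"
      using nonneg that by force
    then show ?thesis
      by (simp only: cdf measure_empty order_refl)
  qed
  then have I_nonneg: "0 \<le> D.I u" if "0 < u" "u < 1" for u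
    using I[OF that, of "D.I u"] that by (smt (verit, best))
  show ?thesis
  proof (rule that[of q])
    show "q \<in> borel_measurable borel"
      unfolding q_def using D.measurable_CI
      by (subst borel_measurable_restrict_space_iff[symmetric]) auto
    show "0 \<le> q u" for u
      using I_nonneg by (auto simp: q_def indicator_def)
    show "q 0 = 0"
      by (simp add: q_def)
    show "mono_on {0<..<1} q"
      using D.mono_I by (auto simp: mono_on_def q)
    show "VaR u M X = ereal (q u)" if u: "0 < u" "u < 1" for u
    proof -
      have "VaR u M X = Inf {ereal x | x. D.I u \<le> x}"
        unfolding VaR_def cdf[symmetric] by (simp add: I[OF u])
      also have "\<dots> = ereal (D.I u)"
        by (rule Inf_eqI) auto
      finally show ?thesis
        using q u by simp
    qed
    fix g :: "real \<Rightarrow> ennreal" assume g[measurable]: "g \<in> borel_measurable borel"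
    have "(\<integral>\<^sup>+ w. g (X w) \<partial>M) = (\<integral>\<^sup>+ x. g x \<partial>distr M borel X)"
      by (simp add: nn_integral_distr)
    also have "\<dots> = (\<integral>\<^sup>+ x. g x \<partial>distr (restrict_space lborel {0<..<1}) borel D.I)"
      by (simp add: D.distr_I_eq_M)
    also have "\<dots> = (\<integral>\<^sup>+ u. g (D.I u) \<partial>restrict_space lborel {0<..<1})"
      by (intro nn_integral_distr) (auto simp: measurable_lborel1 cong: measurable_cong_sets sets_restrict_space_cong)
    also have "\<dots> = (\<integral>\<^sup>+ u\<in>{0<..<1}. g (D.I u) \<partial>lborel)"
      by (simp add: nn_integral_restrict_space)
    also have "\<dots> = (\<integral>\<^sup>+ u\<in>{0<..<1}. g (q u) \<partial>lborel)"
      by (intro nn_integral_cong) (auto simp: q indicator_def)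
    finally show "(\<integral>\<^sup>+ w. g (X w) \<partial>M) = (\<integral>\<^sup>+ u\<in>{0<..<1}. g (q u) \<partial>lborel)" .
  qed
qed

lemma CVaR_quantile:
  assumes "0 \<le> \<alpha>" "\<And>u. 0 < u \<Longrightarrow> u < 1 \<Longrightarrow> VaR u M X = ereal (q u)"
  shows "CVaR \<alpha> M X = ennreal (1 / (1 - \<alpha>)) * (\<integral>\<^sup>+ u\<in>{\<alpha><..<1}. ennreal (q u) \<partial>lborel)"
proof -
  \<comment> \<open>The end points have measure zero, and \<open>VaR\<close> may be infinite there:
    it is \<open>-\<infinity>\<close> at level \<open>0\<close> and possibly \<open>\<infinity>\<close> at level \<open>1\<close>.\<close>
  have "AE u in lborel. e2ennreal (VaR u M X) * indicator {\<alpha>..1} u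
      = ennreal (q u) * indicator {\<alpha><..<1} u"
    using AE_lborel_singleton[of \<alpha>] AE_lborel_singleton[of 1]
  proof eventually_elim
    case (elim u)
    then show ?case
      using assms by (auto simp: indicator_def e2ennreal_ereal)
  qed
  then show ?thesis
    unfolding CVaR_def by (subst nn_integral_cong_AE) auto
qed

text \<open>Above level \<open>\<alpha>\<close> the quantile function lies above its value \<open>t\<close> at \<open>\<alpha>\<close>, below that level
  it lies below. So the integral over \<open>(\<alpha>, 1)\<close> splits into the constant \<open>t\<close> and the expected
  excess of \<open>X\<close> over \<open>t\<close>. This is the minimum in the Rockafellar-Uryasev formula, attained at
  \<open>t = VaR\<^sub>\<alpha>\<close> for \<open>\<alpha> > 0\<close> and at \<open>t = 0\<close> for \<open>\<alpha> = 0\<close>.\<close>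

lemma CVaR_eq_threshold_plus_excess:
  assumes "prob_space M" "X \<in> borel_measurable M" "\<And>w. w \<in> space M \<Longrightarrow> 0 \<le> X w"
    and \<alpha>: "0 \<le> \<alpha>" "\<alpha> < 1"
  obtains t where "0 \<le> t"
    "CVaR \<alpha> M X = ennreal t + ennreal (1 / (1 - \<alpha>)) * (\<integral>\<^sup>+ w. ennreal (X w - t) \<partial>M)"
proof -
  obtain q :: "real \<Rightarrow> real" where q:
    "q \<in> borel_measurable borel" "\<And>u. 0 \<le> q u" "q 0 = 0" "mono_on {0<..<1} q"
    "\<And>u. 0 < u \<Longrightarrow> u < 1 \<Longrightarrow> VaR u M X = ereal (q u)"
    "\<And>g :: real \<Rightarrow> ennreal. g \<in> borel_measurable borel \<Longrightarrow>
       (\<integral>\<^sup>+ w. g (X w) \<partial>M) = (\<integral>\<^sup>+ u\<in>{0<..<1}. g (q u) \<partial>lborel)"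
    using quantile_function[OF assms(1-3)] by blast
  note [measurable] = q(1)
  define t where "t = q \<alpha>"
  have above: "t \<le> q u" if "\<alpha> < u" "u < 1" for u
  proof (cases "\<alpha> = 0")
    case False
    then show ?thesis
      using q(4) that \<alpha> by (auto simp: t_def mono_on_def)
  qed (use q(2,3) in \<open>simp add: t_def\<close>)
  have below: "q u \<le> t" if "0 < u" "u \<le> \<alpha>" for u
    using q(4) that \<alpha> by (auto simp: t_def mono_on_def)
  have "(\<integral>\<^sup>+ u\<in>{\<alpha><..<1}. ennreal (q u) \<partial>lborel)
      = (\<integral>\<^sup>+ u. ennreal t * indicator {\<alpha><..<1} u + ennreal (q u - t) * indicator {0<..<1} u \<partial>lborel)"
  proof (intro nn_integral_cong)
    fix u :: real
    consider "\<alpha> < u" "u < 1" | "0 < u" "u \<le> \<alpha>" | "u \<le> 0 \<or> 1 \<le> u"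
      by linarith
    then show "ennreal (q u) * indicator {\<alpha><..<1} u
        = ennreal t * indicator {\<alpha><..<1} u + ennreal (q u - t) * indicator {0<..<1} u"
    proof cases
      case 1
      then show ?thesis
        using above[of u] q(2)[of \<alpha>] \<alpha> by (simp add: t_def flip: ennreal_plus)
    next
      case 2
      then show ?thesis
        using below[of u] \<alpha> by (simp add: ennreal_neg)
    qed (use \<alpha> in auto)
  qed
  also have "\<dots> = ennreal t * ennreal (1 - \<alpha>) + (\<integral>\<^sup>+ w. ennreal (X w - t) \<partial>M)"
    using q(6)[of "\<lambda>x. ennreal (x - t)"] \<alpha> by (subst nn_integral_add) (auto simp: nn_integral_cmult)
  finally have "CVaR \<alpha> M X = ennreal (1 / (1 - \<alpha>)) *
      (ennreal t * ennreal (1 - \<alpha>) + (\<integral>\<^sup>+ w. ennreal (X w - t) \<partial>M))"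
    using CVaR_quantile[of \<alpha> M X q] \<alpha> q(5) by simp
  also have "\<dots> = ennreal t + ennreal (1 / (1 - \<alpha>)) * (\<integral>\<^sup>+ w. ennreal (X w - t) \<partial>M)"
    using \<alpha> q(2)[of \<alpha>] by (simp add: distrib_left t_def flip: ennreal_mult)
  finally show ?thesis
    using that[of t] q(2)[of \<alpha>] by (simp add: t_def)
qed

lemma CVaR_le_ess_sup:
  assumes "prob_space M" and X[measurable]: "X \<in> borel_measurable M"
    and "\<And>w. w \<in> space M \<Longrightarrow> 0 \<le> X w" and \<alpha>: "0 \<le> \<alpha>" "\<alpha> < 1"
  shows "CVaR \<alpha> M X \<le> ess_sup M X"
proof -
  obtain q :: "real \<Rightarrow> real" where q:
    "q \<in> borel_measurable borel" "\<And>u. 0 \<le> q u" "q 0 = 0" "mono_on {0<..<1} q"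
    "\<And>u. 0 < u \<Longrightarrow> u < 1 \<Longrightarrow> VaR u M X = ereal (q u)"
    "\<And>g :: real \<Rightarrow> ennreal. g \<in> borel_measurable borel \<Longrightarrow>
       (\<integral>\<^sup>+ w. g (X w) \<partial>M) = (\<integral>\<^sup>+ u\<in>{0<..<1}. g (q u) \<partial>lborel)"
    using quantile_function[OF assms(1-3)] by blast
  note [measurable] = q(1)
  define s where "s = ess_sup M X"
  have "AE w in M. ennreal (X w) \<le> s"
    unfolding s_def ess_sup_def by (rule esssup_AE)
  \<comment> \<open>Equality of laws carries the almost sure bound from \<open>X\<close> over to its quantile function.\<close>
  then have "(\<integral>\<^sup>+ w. indicator {x. s < ennreal x} (X w) \<partial>M) = 0"
    by (subst nn_integral_0_iff_AE) (auto simp: indicator_def not_less)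
  then have "(\<integral>\<^sup>+ u\<in>{0<..<1}. indicator {x. s < ennreal x} (q u) \<partial>lborel) = 0"
    by (subst q(6)[symmetric]) auto
  then have "AE u in lborel. (indicator {x. s < ennreal x} (q u) :: ennreal) * indicator {0<..<1} u = 0"
    by (subst (asm) nn_integral_0_iff_AE) auto
  then have "AE u in lborel. ennreal (q u) * indicator {\<alpha><..<1} u \<le> s * indicator {\<alpha><..<1} u"
    by eventually_elim (use \<alpha> in \<open>auto simp: indicator_def not_less split: if_splits\<close>)
  then have "(\<integral>\<^sup>+ u\<in>{\<alpha><..<1}. ennreal (q u) \<partial>lborel) \<le> (\<integral>\<^sup>+ u. s * indicator {\<alpha><..<1} u \<partial>lborel)"
    by (rule nn_integral_mono_AE)
  also have "\<dots> = s * ennreal (1 - \<alpha>)"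
    using \<alpha> by (simp add: nn_integral_cmult)
  finally have "CVaR \<alpha> M X \<le> ennreal (1 / (1 - \<alpha>)) * (s * ennreal (1 - \<alpha>))"
    using CVaR_quantile[of \<alpha> M X q] \<alpha> q(5) by (simp add: mult_left_mono)
  also have "\<dots> = s * (ennreal (1 / (1 - \<alpha>)) * ennreal (1 - \<alpha>))"
    by (simp add: ac_simps)
  also have "\<dots> = s"
    using \<alpha> by (simp flip: ennreal_mult)
  finally show ?thesis
    by (simp add: s_def)
qed

lemma CVaR_le_mean:
  assumes "prob_space M" "X \<in> borel_measurable M" "\<And>w. w \<in> space M \<Longrightarrow> 0 \<le> X w"
    and \<alpha>: "0 \<le> \<alpha>" "\<alpha> < 1"
  shows "CVaR \<alpha> M X \<le> ennreal (1 / (1 - \<alpha>)) * mean M X"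
proof -
  obtain q :: "real \<Rightarrow> real" where q:
    "q \<in> borel_measurable borel" "\<And>u. 0 \<le> q u" "q 0 = 0" "mono_on {0<..<1} q"
    "\<And>u. 0 < u \<Longrightarrow> u < 1 \<Longrightarrow> VaR u M X = ereal (q u)"
    "\<And>g :: real \<Rightarrow> ennreal. g \<in> borel_measurable borel \<Longrightarrow>
       (\<integral>\<^sup>+ w. g (X w) \<partial>M) = (\<integral>\<^sup>+ u\<in>{0<..<1}. g (q u) \<partial>lborel)"
    using quantile_function[OF assms(1-3)] by blast
  have "(\<integral>\<^sup>+ u\<in>{\<alpha><..<1}. ennreal (q u) \<partial>lborel) \<le> (\<integral>\<^sup>+ u\<in>{0<..<1}. ennreal (q u) \<partial>lborel)"
    using \<alpha> by (intro nn_integral_mono) (auto simp: indicator_def)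
  also have "\<dots> = mean M X"
    unfolding mean_def by (subst q(6)) auto
  finally show ?thesis
    using CVaR_quantile[of \<alpha> M X q] \<alpha> q(5) by (simp add: mult_left_mono)
qed

section \<open>Couplings with the empirical distribution\<close>

lemma empirical_eq_distr_pmf_of_set:
  assumes "N \<ge> 1"
  shows "empirical N xi = distr (measure_pmf (pmf_of_set {1..N})) borel xi"
proof (rule measure_eqI)
  fix A assume "A \<in> sets (empirical N xi)"
  then have A: "A \<in> sets borel"
    by (simp add: empirical_def)
  have "xi \<in> uniform_count_measure {1..N} \<rightarrow>\<^sub>M borel"
    by (simp add: measurable_def space_uniform_count_measure sets_uniform_count_measure)
  then show "emeasure (empirical N xi) A = emeasure (distr (measure_pmf (pmf_of_set {1..N})) borel xi) A"
    using assms A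
    by (simp add: empirical_def emeasure_distr space_uniform_count_measure
        emeasure_uniform_count_measure emeasure_pmf_of_set Int_commute)
qed (simp add: empirical_def)

lemma integral_empirical:
  fixes h :: "real ^ 'n \<Rightarrow> real"
  assumes "N \<ge> 1" and h: "h \<in> borel_measurable borel"
  shows "integrable (empirical N xi) h"
    and "integral\<^sup>L (empirical N xi) h = (\<Sum>i=1..N. h (xi i)) / real N"
  using assms
  by (auto simp: empirical_eq_distr_pmf_of_set integrable_distr_eq integral_distr
      integral_pmf_of_set intro!: integrable_measure_pmf_finite)

lemma transport_cost_measurable:
  fixes nrm :: "real ^ 'n \<Rightarrow> real"
  assumes "is_norm nrm" "Q \<in> couplings P0 P"
  shows "(\<lambda>(x, y). nrm (x - y)) \<in> borel_measurable Q"
proof -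
  have [measurable]: "nrm \<in> borel_measurable borel"
    using norm_continuous[OF assms(1)] by (rule borel_measurable_continuous_onI)
  have "(\<lambda>(x, y). nrm (x - y)) \<in> borel_measurable (borel \<Otimes>\<^sub>M borel)"
    by measurable
  then show ?thesis
    using assms(2) by (simp add: couplings_def cong: measurable_cong_sets)
qed

text \<open>The common upper bound behind all three worst cases: moves of length up to \<open>t\<close> are charged
  to the largest loss on the sphere of radius \<open>t\<close>, and the remaining lengths at rate \<open>K\<close>.\<close>

lemma expectation_le_by_coupling:
  fixes nrm :: "real ^ 'n \<Rightarrow> real"
  assumes nrm: "is_norm nrm" and l: "convex_on UNIV l"
    and K: "max_subgradient_norm nrm l = ereal K" "0 \<le> K"
    and "N \<ge> 1" and Q: "Q \<in> couplings (empirical N xi) P"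
    and "0 \<le> t" "0 \<le> c" and excess: "(\<integral>\<^sup>+ z. ennreal ((case z of (x, y) \<Rightarrow> nrm (x - y)) - t) \<partial>Q) \<le> ennreal c"
  shows "integrable P l"
    and "integral\<^sup>L P l \<le> (\<Sum>i=1..N. sphere_max nrm l (xi i) t) / real N + K * c"
proof -
  define d where "d = (\<lambda>(x, y). nrm (x - y))"
  define m where "m z = max 0 (d z - t)" for z
  interpret Q: prob_space Q
    using Q by (simp add: couplings_def)
  have sets_Q[measurable_cong]: "sets Q = sets (borel \<Otimes>\<^sub>M borel)"
    and marginals: "distr Q borel fst = empirical N xi" "distr Q borel snd = P"
    using Q by (auto simp: couplings_def)
  have [measurable]: "d \<in> borel_measurable Q"
    unfolding d_def by (rule transport_cost_measurable[OF nrm Q])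
  have [measurable]: "m \<in> borel_measurable Q"
    unfolding m_def by measurable
  have "continuous_on UNIV l"
    using convex_on_continuous l by blast
  then have l_meas[measurable]: "l \<in> borel_measurable borel"
    by (rule borel_measurable_continuous_onI)
  note h_meas[measurable] = sphere_max_measurable[OF nrm l, of t]
  have nn_m: "(\<integral>\<^sup>+ z. ennreal (m z) \<partial>Q) \<le> ennreal c"
    using excess by (simp add: m_def d_def ennreal_max_0)
  then have int_m: "integrable Q m"
    by (intro integrableI_nonneg) (auto simp: m_def intro: le_less_trans)
  have "ennreal (\<integral>z. m z \<partial>Q) = (\<integral>\<^sup>+ z. ennreal (m z) \<partial>Q)"
    by (intro nn_integral_eq_integral[symmetric] int_m) (simp add: m_def)
  then have integral_m: "(\<integral>z. m z \<partial>Q) \<le> c"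
    using nn_m \<open>0 \<le> c\<close> by (metis ennreal_le_iff)
  have int_fst: "integrable Q (\<lambda>z. k (fst z))"
    "(\<integral>z. k (fst z) \<partial>Q) = (\<Sum>i=1..N. k (xi i)) / real N"
    if [measurable]: "k \<in> borel_measurable borel" for k :: "real ^ 'n \<Rightarrow> real"
    using integral_empirical[OF \<open>N \<ge> 1\<close> that, of xi] integrable_distr_eq[of fst Q borel k]
      integral_distr[of fst Q borel k] by (simp_all add: marginals)
  have int_l: "integrable Q (\<lambda>z. l (snd z))"
  proof (rule Bochner_Integration.integrable_bound)
    show "integrable Q (\<lambda>z. \<bar>l (fst z)\<bar> + K * (t + m z))"
      using int_fst(1)[of "\<lambda>x. \<bar>l x\<bar>"] int_m by auto
    have "\<bar>l y\<bar> \<le> \<bar>l x\<bar> + K * (t + m (x, y))" for x y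
    proof -
      have "K * nrm (x - y) \<le> K * (t + m (x, y))"
        using K(2) by (intro mult_left_mono) (auto simp: m_def d_def)
      moreover have "l x \<le> l y + K * nrm (x - y)"
        using convex_lipschitz[OF nrm l K(1), of x y] by (simp add: norm_symmetric[OF nrm, of x y])
      ultimately show ?thesis
        using convex_lipschitz[OF nrm l K(1), of y x] by linarith
    qed
    then show "AE z in Q. norm (l (snd z)) \<le> norm (\<bar>l (fst z)\<bar> + K * (t + m z))"
      by (intro AE_I2) (smt (verit, ccfv_SIG) prod.collapse real_norm_def)
  qed measurable
  then show "integrable P l"
    using integrable_distr_eq[of snd Q borel l] by (simp add: marginals)
  have "integral\<^sup>L P l = (\<integral>z. l (snd z) \<partial>Q)"
    using integral_distr[of snd Q borel l] by (simp add: marginals)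
  also have "\<dots> \<le> (\<integral>z. sphere_max nrm l (fst z) t + K * m z \<partial>Q)"
  proof (rule integral_mono[OF int_l])
    show "integrable Q (\<lambda>z. sphere_max nrm l (fst z) t + K * m z)"
      using int_fst(1)[OF h_meas] int_m by simp
    show "l (snd z) \<le> sphere_max nrm l (fst z) t + K * m z" for z
      using le_sphere_max_plus_excess[OF nrm l K(1) \<open>0 \<le> t\<close>, of "snd z" "fst z"]
      by (simp add: m_def d_def case_prod_beta)
  qed
  also have "\<dots> = (\<Sum>i=1..N. sphere_max nrm l (xi i) t) / real N + K * (\<integral>z. m z \<partial>Q)"
    using int_fst[OF h_meas] int_m by simp
  also have "\<dots> \<le> (\<Sum>i=1..N. sphere_max nrm l (xi i) t) / real N + K * c"
    using integral_m K(2) by (simp add: mult_left_mono)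
  finally show "integral\<^sup>L P l \<le> (\<Sum>i=1..N. sphere_max nrm l (xi i) t) / real N + K * c" .
qed

lemma transport_ball_near_optimal_coupling:
  assumes "P \<in> transport_ball nrm \<rho> r P0" "0 \<le> r" "0 < \<delta>"
  obtains Q where "Q \<in> couplings P0 P" "\<rho> Q (\<lambda>(x, y). nrm (x - y)) < ennreal (r + \<delta>)"
proof -
  have "transport_dist nrm \<rho> P0 P \<le> ennreal r"
    using assms by (simp add: transport_ball_def)
  also have "\<dots> < ennreal (r + \<delta>)"
    using assms by (simp add: ennreal_less_iff)
  finally show ?thesis
    using that by (auto simp: transport_dist_def INF_less_iff)
qed

text \<open>Every pair of vector-valued functions on a discrete probability space is a coupling of
  their laws. The extremal distributions are given in this form.\<close>

lemma distr_pair_pmf_in_couplings: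
  fixes X Y :: "'a \<Rightarrow> real ^ 'n"
  shows "distr (measure_pmf p) (borel \<Otimes>\<^sub>M borel) (\<lambda>w. (X w, Y w))
    \<in> couplings (distr (measure_pmf p) borel X) (distr (measure_pmf p) borel Y)"
proof -
  have pair: "(\<lambda>w. (X w, Y w)) \<in> measure_pmf p \<rightarrow>\<^sub>M borel \<Otimes>\<^sub>M borel"
    by (intro measurable_Pair) auto
  then show ?thesis
    by (simp add: couplings_def distr_distr[OF _ pair] comp_def
        prob_space.prob_space_distr[OF prob_space_measure_pmf pair])
qed

lemma pmf_in_transport_ball:
  fixes X Y :: "'a \<Rightarrow> real ^ 'n"
  assumes "\<rho> (distr (measure_pmf p) (borel \<Otimes>\<^sub>M borel) (\<lambda>w. (X w, Y w))) (\<lambda>(x, y). nrm (x - y))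
      \<le> ennreal r"
  shows "distr (measure_pmf p) borel Y \<in> transport_ball nrm \<rho> r (distr (measure_pmf p) borel X)"
  using distr_pair_pmf_in_couplings[of p X Y] assms
  by (auto simp: transport_ball_def prob_dists_def transport_dist_def
      intro!: prob_space.prob_space_distr prob_space_measure_pmf INF_lower2)

section \<open>Upper bounds\<close>

lemma le_of_le_add_mult_eps:
  fixes a b K :: real
  assumes "0 \<le> K" "\<And>\<delta>. 0 < \<delta> \<Longrightarrow> a \<le> b + K * \<delta>"
  shows "a \<le> b"
proof (rule field_le_epsilon)
  fix e :: real assume "0 < e"
  \<comment> \<open>The denominator \<open>K + 1\<close> rather than \<open>K\<close> covers \<open>K = 0\<close>.\<close>
  then have "a \<le> b + K * (e / (K + 1))"
    using assms by (intro assms(2)) auto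
  also have "K * (e / (K + 1)) \<le> e"
    using assms(1) \<open>0 < e\<close> by (simp add: field_simps)
  finally show "a \<le> b + e"
    by simp
qed

context
  fixes nrm :: "real ^ 'n \<Rightarrow> real" and l :: "real ^ 'n \<Rightarrow> real" and K :: real
    and N :: nat and xi :: "nat \<Rightarrow> real ^ 'n"
  assumes nrm: "is_norm nrm" and l: "convex_on UNIV l"
    and K: "max_subgradient_norm nrm l = ereal K" "0 \<le> K"
    and N: "N \<ge> 1"
begin

lemma average_sphere_max_lipschitz:
  assumes "s \<le> t"
  shows "(\<Sum>i=1..N. sphere_max nrm l (xi i) t) / real N
    \<le> (\<Sum>i=1..N. sphere_max nrm l (xi i) s) / real N + K * (t - s)"
proof -
  have "(\<Sum>i=1..N. sphere_max nrm l (xi i) t) \<le> (\<Sum>i=1..N. sphere_max nrm l (xi i) s + K * (t - s))"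
    by (intro sum_mono sphere_max_lipschitz_radius nrm l K assms)
  then have "(\<Sum>i=1..N. sphere_max nrm l (xi i) t) / real N
      \<le> ((\<Sum>i=1..N. sphere_max nrm l (xi i) s) + real N * (K * (t - s))) / real N"
    by (simp add: sum.distrib divide_right_mono)
  then show ?thesis
    using N by (simp add: add_divide_distrib)
qed

lemma expect_le_of_ball_wc:
  assumes "0 \<le> \<epsilon>" "P \<in> ball_wc nrm \<epsilon> (empirical N xi)"
  shows "expect P l \<le> ereal ((\<Sum>i=1..N. sphere_max nrm l (xi i) \<epsilon>) / real N)"
proof -
  have *: "integrable P l \<and> integral\<^sup>L P l \<le> (\<Sum>i=1..N. sphere_max nrm l (xi i) \<epsilon>) / real N + K * \<delta>"
    if \<delta>: "0 < \<delta>" for \<delta>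
  proof -
    obtain Q where Q: "Q \<in> couplings (empirical N xi) P"
      "ess_sup Q (\<lambda>(x, y). nrm (x - y)) < ennreal (\<epsilon> + \<delta>)"
      using transport_ball_near_optimal_coupling[OF assms(2,1) \<delta>] by blast
    have "AE z in Q. ennreal (case z of (x, y) \<Rightarrow> nrm (x - y)) \<le> ess_sup Q (\<lambda>(x, y). nrm (x - y))"
      unfolding ess_sup_def by (rule esssup_AE)
    then have "AE z in Q. ennreal ((case z of (x, y) \<Rightarrow> nrm (x - y)) - (\<epsilon> + \<delta>)) = 0"
    proof eventually_elim
      case (elim z)
      then have "ennreal (case z of (x, y) \<Rightarrow> nrm (x - y)) < ennreal (\<epsilon> + \<delta>)"
        using Q(2) by (rule le_less_trans)
      then have "(case z of (x, y) \<Rightarrow> nrm (x - y)) < \<epsilon> + \<delta>"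
        by (simp add: ennreal_less_iff case_prod_beta norm_nonneg[OF nrm])
      then show ?case
        by (simp add: ennreal_neg)
    qed
    then have "(\<integral>\<^sup>+ z. ennreal ((case z of (x, y) \<Rightarrow> nrm (x - y)) - (\<epsilon> + \<delta>)) \<partial>Q) = (\<integral>\<^sup>+ z. 0 \<partial>Q)"
      by (rule nn_integral_cong_AE)
    then have "(\<integral>\<^sup>+ z. ennreal ((case z of (x, y) \<Rightarrow> nrm (x - y)) - (\<epsilon> + \<delta>)) \<partial>Q) \<le> ennreal 0"
      by simp
    note expectation_le_by_coupling[OF nrm l K N Q(1) _ _ this]
    then have "integrable P l" "integral\<^sup>L P l \<le> (\<Sum>i=1..N. sphere_max nrm l (xi i) (\<epsilon> + \<delta>)) / real N"
      using assms(1) \<delta> by auto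
    then show ?thesis
      using average_sphere_max_lipschitz[of \<epsilon> "\<epsilon> + \<delta>"] \<delta> by auto
  qed
  then have "integrable P l"
    using zero_less_one by blast
  moreover have "integral\<^sup>L P l \<le> (\<Sum>i=1..N. sphere_max nrm l (xi i) \<epsilon>) / real N"
    using * by (blast intro: le_of_le_add_mult_eps[OF K(2)])
  ultimately show ?thesis
    by (simp only: expect_eq_integral ereal_less_eq)
qed

lemma expect_le_of_ball_W:
  assumes "0 \<le> r" "P \<in> ball_W nrm r (empirical N xi)"
  shows "expect P l \<le> ereal ((\<Sum>i=1..N. l (xi i)) / real N + K * r)"
proof -
  have *: "integrable P l \<and> integral\<^sup>L P l \<le> ((\<Sum>i=1..N. l (xi i)) / real N + K * r) + K * \<delta>"
    if \<delta>: "0 < \<delta>" for \<delta>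
  proof -
    obtain Q where Q: "Q \<in> couplings (empirical N xi) P"
      "mean Q (\<lambda>(x, y). nrm (x - y)) < ennreal (r + \<delta>)"
      using transport_ball_near_optimal_coupling[OF assms(2,1) \<delta>] by blast
    then have "(\<integral>\<^sup>+ z. ennreal ((case z of (x, y) \<Rightarrow> nrm (x - y)) - 0) \<partial>Q) \<le> ennreal (r + \<delta>)"
      by (simp add: mean_def)
    note expectation_le_by_coupling[OF nrm l K N Q(1) _ _ this]
    then show ?thesis
      using assms(1) \<delta> by (simp add: sphere_max_radius_zero[OF nrm l] distrib_left add.assoc)
  qed
  then have "integrable P l"
    using zero_less_one by blast
  moreover have "integral\<^sup>L P l \<le> (\<Sum>i=1..N. l (xi i)) / real N + K * r"
    using * by (blast intro: le_of_le_add_mult_eps[OF K(2)])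
  ultimately show ?thesis
    by (simp only: expect_eq_integral ereal_less_eq)
qed

text \<open>Splitting the transport cost at \<open>t = VaR\<^sub>\<alpha>\<close> bounds the expectation by a convex function of
  \<open>t \<in> [0, s]\<close>. Its value at \<open>t = s\<close> is the type-infinity bound, where all mass moves by at
  most \<open>s\<close>. Its value at \<open>t = 0\<close> is the type-1 bound, where the whole budget \<open>(1 - \<alpha>) * s\<close> is
  spent at the asymptotic slope \<open>K\<close>.\<close>

lemma threshold_bound_le_max:
  assumes "0 \<le> \<alpha>" "\<alpha> < 1" "0 < s" "0 \<le> t" "t \<le> s"
  shows "(\<Sum>i=1..N. sphere_max nrm l (xi i) t) / real N + K * ((1 - \<alpha>) * (s - t))
    \<le> max ((\<Sum>i=1..N. sphere_max nrm l (xi i) s) / real N)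
        ((\<Sum>i=1..N. l (xi i)) / real N + K * ((1 - \<alpha>) * s))" (is "?f + _ \<le> max ?A ?B")
proof -
  define v where "v = t / s"
  have v: "0 \<le> v" "v \<le> 1" "t = v * s"
    using assms by (auto simp: v_def)
  have "(\<Sum>i=1..N. sphere_max nrm l (xi i) t)
      \<le> (\<Sum>i=1..N. (1 - v) * l (xi i) + v * sphere_max nrm l (xi i) s)"
  proof (rule sum_mono)
    fix i
    show "sphere_max nrm l (xi i) t \<le> (1 - v) * l (xi i) + v * sphere_max nrm l (xi i) s"
      using sphere_max_convex[OF nrm l, of "1 - v" v "xi i" "xi i" 0 s] v
      by (simp add: sphere_max_radius_zero[OF nrm l] flip: scaleR_add_left)
  qed
  then have "?f \<le> ((1 - v) * (\<Sum>i=1..N. l (xi i)) + v * (\<Sum>i=1..N. sphere_max nrm l (xi i) s)) / real N"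
    by (simp only: sum.distrib sum_distrib_left[symmetric] divide_right_mono of_nat_0_le_iff)
  then have "?f \<le> (1 - v) * ((\<Sum>i=1..N. l (xi i)) / real N) + v * ?A"
    by (simp add: add_divide_distrib)
  then have "?f + K * ((1 - \<alpha>) * (s - t)) \<le> (1 - v) * ?B + v * ?A"
    unfolding v(3) by (simp add: algebra_simps)
  also have "\<dots> \<le> (1 - v) * max ?A ?B + v * max ?A ?B"
    using v by (intro add_mono mult_left_mono) auto
  finally show ?thesis
    by (simp add: algebra_simps)
qed

lemma expect_le_of_ball_CVaR:
  assumes "0 \<le> \<epsilon>" and \<alpha>: "0 \<le> \<alpha>" "\<alpha> < 1" and P: "P \<in> ball_CVaR nrm \<alpha> \<epsilon> (empirical N xi)"
  shows "expect P l \<le> ereal (max ((\<Sum>i=1..N. sphere_max nrm l (xi i) \<epsilon>) / real N)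
      ((\<Sum>i=1..N. l (xi i)) / real N + K * ((1 - \<alpha>) * \<epsilon>)))" (is "_ \<le> ereal ?M")
proof -
  have *: "integrable P l \<and> integral\<^sup>L P l \<le> ?M + K * \<delta>" if \<delta>: "0 < \<delta>" for \<delta>
  proof -
    define s where "s = \<epsilon> + \<delta>"
    have "0 < s"
      using assms(1) \<delta> by (simp add: s_def)
    let ?d = "\<lambda>(x, y). nrm (x - y)"
    obtain Q where Q: "Q \<in> couplings (empirical N xi) P" "CVaR \<alpha> Q ?d < ennreal s"
      using transport_ball_near_optimal_coupling[OF P assms(1) \<delta>] unfolding s_def by blast
    have d_nonneg: "0 \<le> ?d z" for z
      by (simp add: case_prod_beta norm_nonneg[OF nrm])
    have "prob_space Q"
      using Q by (simp add: couplings_def)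
    then obtain t where t: "0 \<le> t"
      "CVaR \<alpha> Q ?d = ennreal t + ennreal (1 / (1 - \<alpha>)) * (\<integral>\<^sup>+ z. ennreal (?d z - t) \<partial>Q)"
      using CVaR_eq_threshold_plus_excess[OF _ transport_cost_measurable[OF nrm Q(1)] d_nonneg \<alpha>]
      by blast
    define E where "E = (\<integral>\<^sup>+ z. ennreal (?d z - t) \<partial>Q)"
    have lt: "ennreal t + ennreal (1 / (1 - \<alpha>)) * E < ennreal s"
      using Q(2) t(2) by (simp add: E_def)
    have "E \<noteq> top"
      using lt \<alpha> by (auto simp: ennreal_mult_top)
    then obtain e where e: "0 \<le> e" "E = ennreal e"
      by (cases E) auto
    have "t + 1 / (1 - \<alpha>) * e < s"
      using lt t(1) e \<alpha> by (simp add: ennreal_less_iff flip: ennreal_mult ennreal_plus)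
    moreover have "0 \<le> 1 / (1 - \<alpha>) * e"
      using e \<alpha> by simp
    ultimately have "t \<le> s" "1 / (1 - \<alpha>) * e \<le> s - t"
      by linarith+
    then have "t \<le> s" "e \<le> (1 - \<alpha>) * (s - t)"
      using \<alpha> by (auto simp: pos_divide_le_eq mult.commute)
    then have "(\<integral>\<^sup>+ z. ennreal (?d z - t) \<partial>Q) \<le> ennreal ((1 - \<alpha>) * (s - t))"
      using e by (simp add: E_def[symmetric] ennreal_leI)
    note bound = expectation_le_by_coupling[OF nrm l K N Q(1) t(1) _ this]
    have "integral\<^sup>L P l \<le> (\<Sum>i=1..N. sphere_max nrm l (xi i) t) / real N + K * ((1 - \<alpha>) * (s - t))"
      using bound(2) \<alpha> \<open>t \<le> s\<close> by simp
    also have "\<dots> \<le> max ((\<Sum>i=1..N. sphere_max nrm l (xi i) s) / real N)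
        ((\<Sum>i=1..N. l (xi i)) / real N + K * ((1 - \<alpha>) * s))"
      by (rule threshold_bound_le_max[OF \<alpha> \<open>0 < s\<close> t(1) \<open>t \<le> s\<close>])
    also have "\<dots> \<le> ?M + K * \<delta>"
    proof -
      have "(1 - \<alpha>) * \<delta> \<le> \<delta>"
        using \<alpha> \<delta> by (simp add: mult_left_le_one_le)
      then have "K * ((1 - \<alpha>) * s) \<le> K * ((1 - \<alpha>) * \<epsilon>) + K * \<delta>"
        using K(2) by (simp add: s_def distrib_left mult_left_mono)
      moreover have "(\<Sum>i=1..N. sphere_max nrm l (xi i) s) / real N
          \<le> (\<Sum>i=1..N. sphere_max nrm l (xi i) \<epsilon>) / real N + K * \<delta>"
        using average_sphere_max_lipschitz[of \<epsilon> s] \<delta> by (simp add: s_def)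
      ultimately show ?thesis
        by linarith
    qed
    finally show ?thesis
      using bound(1) \<alpha> \<open>t \<le> s\<close> by simp
  qed
  then have "integrable P l"
    using zero_less_one by blast
  moreover have "integral\<^sup>L P l \<le> ?M"
    using * by (blast intro: le_of_le_add_mult_eps[OF K(2)])
  ultimately show ?thesis
    by (simp only: expect_eq_integral ereal_less_eq)
qed

section \<open>Extremal distributions\<close>

text \<open>Each atom moves to the worst point of the sphere around it.\<close>

lemma worst_case_ball_wc_ge:
  assumes "0 \<le> \<epsilon>"
  shows "ereal ((\<Sum>i=1..N. sphere_max nrm l (xi i) \<epsilon>) / real N)
    \<le> worst_case (ball_wc nrm \<epsilon> (empirical N xi)) l"
proof -
  have "\<forall>i. \<exists>e. nrm e = 1 \<and> sphere_max nrm l (xi i) \<epsilon> = l (xi i + \<epsilon> *\<^sub>R e)"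
    using sphere_max_attained[OF nrm l] by metis
  then obtain e where e: "\<And>i. nrm (e i) = 1"
    "\<And>i. sphere_max nrm l (xi i) \<epsilon> = l (xi i + \<epsilon> *\<^sub>R e i)"
    by metis
  define Y where "Y i = xi i + \<epsilon> *\<^sub>R e i" for i
  let ?p = "pmf_of_set {1..N}"
  let ?Q = "distr (measure_pmf ?p) (borel \<Otimes>\<^sub>M borel) (\<lambda>i. (xi i, Y i))"
  have len: "nrm (xi i - Y i) = \<epsilon>" for i
    using norm_homogeneous[OF nrm, of "-\<epsilon>" "e i"] assms e by (simp add: Y_def)
  have pair: "(\<lambda>i. (xi i, Y i)) \<in> measure_pmf ?p \<rightarrow>\<^sub>M borel \<Otimes>\<^sub>M borel"
    by (intro measurable_Pair) auto
  have cost: "(\<lambda>(x, y). nrm (x - y)) \<in> borel_measurable (borel \<Otimes>\<^sub>M borel)"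
    using transport_cost_measurable[OF nrm distr_pair_pmf_in_couplings[of ?p xi Y]] by simp
  note [measurable] = cost
  have "AE z in ?Q. ennreal ((\<lambda>(x, y). nrm (x - y)) z) \<le> ennreal \<epsilon>"
    by (subst AE_distr_iff[OF pair]) (auto simp: len)
  then have "ess_sup ?Q (\<lambda>(x, y). nrm (x - y)) \<le> ennreal \<epsilon>"
    unfolding ess_sup_def by (intro esssup_I) auto
  then have "distr ?p borel Y \<in> ball_wc nrm \<epsilon> (empirical N xi)"
    unfolding empirical_eq_distr_pmf_of_set[OF N] by (rule pmf_in_transport_ball)
  then have "empirical N Y \<in> ball_wc nrm \<epsilon> (empirical N xi)"
    by (simp only: empirical_eq_distr_pmf_of_set[OF N])
  then have "expect (empirical N Y) l \<le> worst_case (ball_wc nrm \<epsilon> (empirical N xi)) l"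
    unfolding worst_case_def by (rule SUP_upper)
  moreover have "l \<in> borel_measurable borel"
    using convex_on_continuous l by (blast intro: borel_measurable_continuous_onI)
  then have "expect (empirical N Y) l = ereal ((\<Sum>i=1..N. l (Y i)) / real N)"
    by (simp only: expect_eq_integral integral_empirical[OF N])
  moreover have "sphere_max nrm l (xi i) \<epsilon> = l (Y i)" for i
    using e(2) by (simp add: Y_def)
  ultimately show ?thesis
    by (simp only:)
qed

text \<open>A vanishing fraction \<open>p\<close> of the mass of every atom travels at most \<open>r / p\<close> in a
  direction in which \<open>l\<close> grows at rate \<open>c\<close>. The cost stays at most \<open>r\<close>, the gain
  tends to at least \<open>r * c\<close>, and \<open>c\<close> can be chosen arbitrarily close to \<open>K\<close>.\<close>

lemma worst_case_ball_W_ge: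
  assumes "0 \<le> r"
  shows "ereal ((\<Sum>i=1..N. l (xi i)) / real N + K * r) \<le> worst_case (ball_W nrm r (empirical N xi)) l"
    (is "ereal (?A + _) \<le> ?S")
proof -
  have l_meas: "l \<in> borel_measurable borel"
    using convex_on_continuous l by (blast intro: borel_measurable_continuous_onI)
  have "ereal (?A + c * r) \<le> ?S" if c: "c < K" for c
  proof -
    obtain x g d where g: "g \<in> subdifferential l x" and d: "nrm d \<le> 1" "c < g \<bullet> d"
      using steep_direction[OF nrm K(1) c] by blast
    define b where "b i = l x + g \<bullet> (xi i - x)" for i
    let ?B = "(\<Sum>i=1..N. b i) / real N"
    have *: "ereal ((1 - p) * ?A + p * ?B + c * r) \<le> ?S" if p: "0 < p" "p < 1" for p
    proof -
      let ?q = "pair_pmf (pmf_of_set {1..N}) (bernoulli_pmf p)"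
      define X where "X z = xi (fst z)" for z :: "nat \<times> bool"
      define Y where "Y z = xi (fst z) + (if snd z then r / p else 0) *\<^sub>R d" for z :: "nat \<times> bool"
      let ?Q = "distr (measure_pmf ?q) (borel \<Otimes>\<^sub>M borel) (\<lambda>z. (X z, Y z))"
      have X: "distr (measure_pmf ?q) borel X = empirical N xi"
      proof -
        have "empirical N xi = distr (measure_pmf (map_pmf fst ?q)) borel xi"
          by (simp add: empirical_eq_distr_pmf_of_set[OF N] map_fst_pair_pmf)
        also have "\<dots> = distr (measure_pmf ?q) borel X"
          unfolding map_pmf_rep_eq X_def by (subst distr_distr) (auto simp: comp_def)
        finally show ?thesis ..
      qed
      have cost: "(\<lambda>(x, y). nrm (x - y)) \<in> borel_measurable (borel \<Otimes>\<^sub>M borel)"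
        using transport_cost_measurable[OF nrm distr_pair_pmf_in_couplings[of ?q X Y]] by simp
      note [measurable] = cost
      have pair: "(\<lambda>z. (X z, Y z)) \<in> measure_pmf ?q \<rightarrow>\<^sub>M borel \<Otimes>\<^sub>M borel"
        by (intro measurable_Pair) auto
      have nrm_d: "nrm (X (i, True) - Y (i, True)) * p \<le> r" for i
        using norm_homogeneous[OF nrm, of "-(r / p)" d] d(1) assms p
        by (simp add: X_def Y_def mult_left_le)
      have nrm_0: "nrm (X (i, False) - Y (i, False)) = 0" for i
        using norm_zero_iff[OF nrm, of 0] by (simp add: X_def Y_def)
      have "mean ?Q (\<lambda>(x, y). nrm (x - y)) = (\<integral>\<^sup>+ z. ennreal (nrm (X z - Y z)) \<partial>?q)"
        unfolding mean_def by (subst nn_integral_distr[OF pair]) auto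
      also have "\<dots> = (\<integral>\<^sup>+ i. ennreal (nrm (X (i, True) - Y (i, True)) * p) \<partial>pmf_of_set {1..N})"
        using p by (simp add: nn_integral_pair_pmf' nrm_0 norm_nonneg[OF nrm] ennreal_mult)
      also have "\<dots> \<le> (\<integral>\<^sup>+ i. ennreal r \<partial>pmf_of_set {1..N})"
        using nrm_d by (intro nn_integral_mono ennreal_leI)
      finally have "mean ?Q (\<lambda>(x, y). nrm (x - y)) \<le> ennreal r"
        by simp
      then have "distr (measure_pmf ?q) borel Y \<in> ball_W nrm r (empirical N xi)"
        unfolding X[symmetric] by (rule pmf_in_transport_ball)
      then have le: "expect (distr (measure_pmf ?q) borel Y) l \<le> ?S"
        unfolding worst_case_def by (rule SUP_upper)
      have fin: "finite (set_pmf ?q)"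
        using N by simp
      have "integrable (measure_pmf ?q) (\<lambda>z. l (Y z))"
        by (rule integrable_measure_pmf_finite[OF fin])
      then have expect: "expect (distr (measure_pmf ?q) borel Y) l = ereal (\<integral>z. l (Y z) \<partial>?q)"
        using l_meas by (simp add: expect_eq_integral integrable_distr_eq integral_distr)
      have "(\<integral>z. l (Y z) \<partial>?q) = (\<Sum>z\<in>{1..N} \<times> UNIV. pmf ?q z * l (Y z))"
        using N by (subst integral_measure_pmf[of "{1..N} \<times> UNIV"]) auto
      also have "\<dots> = (\<Sum>i=1..N. p * l (Y (i, True)) + (1 - p) * l (xi i)) / real N"
        using N p by (simp add: sum.cartesian_product' pmf_pair UNIV_bool Y_def sum_divide_distrib
            add_divide_distrib add.commute)
      finally have gain: "(\<integral>z. l (Y z) \<partial>?q)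
          = (\<Sum>i=1..N. p * l (Y (i, True)) + (1 - p) * l (xi i)) / real N" .
      have "(1 - p) * ?A + p * ?B + c * r
          = (\<Sum>i=1..N. p * b i + c * r + (1 - p) * l (xi i)) / real N"
        using N by (simp add: sum.distrib sum_distrib_left[symmetric] add_divide_distrib)
      also have "\<dots> \<le> (\<Sum>i=1..N. p * l (Y (i, True)) + (1 - p) * l (xi i)) / real N"
      proof (intro divide_right_mono sum_mono add_right_mono)
        fix i
        have "l x + g \<bullet> (Y (i, True) - x) \<le> l (Y (i, True))"
          using g by (simp add: subdifferential_def)
        moreover have "Y (i, True) - x = (xi i - x) + (r / p) *\<^sub>R d"
          by (simp add: Y_def)
        ultimately have "b i + (r / p) * (g \<bullet> d) \<le> l (Y (i, True))"
          by (simp only: b_def inner_add_right inner_scaleR_right add.assoc)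
        then have "p * (b i + (r / p) * (g \<bullet> d)) \<le> p * l (Y (i, True))"
          using p by (intro mult_left_mono) auto
        moreover have "c * r \<le> r * (g \<bullet> d)"
          using mult_left_mono[of c "g \<bullet> d" r] d(2) assms by (simp add: mult.commute)
        ultimately show "p * b i + c * r \<le> p * l (Y (i, True))"
          using p by (simp add: distrib_left)
      qed simp
      finally have "ereal ((1 - p) * ?A + p * ?B + c * r) \<le> expect (distr (measure_pmf ?q) borel Y) l"
        by (simp only: expect gain ereal_less_eq)
      then show ?thesis
        using le by (rule order_trans)
    qed
    have "((\<lambda>p. ereal ((1 - p) * ?A + p * ?B + c * r)) \<longlongrightarrow> ereal ((1 - 0) * ?A + 0 * ?B + c * r)) (at_right 0)"
      by (intro tendsto_intros)
    moreover have "\<forall>\<^sub>F p in at_right 0. ereal ((1 - p) * ?A + p * ?B + c * r) \<le> ?S"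
      using * by (auto simp: eventually_at_right[of 0 1] intro!: exI[of _ 1])
    ultimately show ?thesis
      by (intro tendsto_upperbound[where F = "at_right 0"]) auto
  qed
  then have "\<forall>\<^sub>F c in at_left K. ereal (?A + c * r) \<le> ?S"
    by (simp add: eventually_at_filter)
  moreover have "((\<lambda>c. ereal (?A + c * r)) \<longlongrightarrow> ereal (?A + K * r)) (at_left K)"
    by (intro tendsto_intros)
  ultimately show ?thesis
    by (intro tendsto_upperbound[where F = "at_left K"]) simp_all
qed

end

section \<open>The CVaR ball and its worst case\<close>

lemma ball_wc_subset_ball_CVaR:
  assumes "is_norm nrm" "0 \<le> \<alpha>" "\<alpha> < 1"
  shows "ball_wc nrm r P0 \<subseteq> ball_CVaR nrm \<alpha> r P0"
proof -
  have "transport_dist nrm (CVaR \<alpha>) P0 P \<le> transport_dist nrm ess_sup P0 P" for P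
    unfolding transport_dist_def
  proof (intro INF_mono bexI)
    fix Q assume Q: "Q \<in> couplings P0 P"
    then have "prob_space Q"
      by (simp add: couplings_def)
    then show "CVaR \<alpha> Q (\<lambda>(x, y). nrm (x - y)) \<le> ess_sup Q (\<lambda>(x, y). nrm (x - y))"
      using norm_nonneg[OF assms(1)]
      by (intro CVaR_le_ess_sup transport_cost_measurable[OF assms(1) Q] assms(2,3))
        (auto split: prod.splits)
  qed
  then show ?thesis
    by (auto simp: transport_ball_def intro: order_trans)
qed

lemma ball_W_subset_ball_CVaR:
  assumes "is_norm nrm" and \<alpha>: "0 \<le> \<alpha>" "\<alpha> < 1" and "0 \<le> r"
  shows "ball_W nrm ((1 - \<alpha>) * r) P0 \<subseteq> ball_CVaR nrm \<alpha> r P0"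
proof
  fix P assume P: "P \<in> ball_W nrm ((1 - \<alpha>) * r) P0"
  have inv: "ennreal (1 - \<alpha>) * ennreal (1 / (1 - \<alpha>)) = 1"
    using \<alpha> by (simp flip: ennreal_mult)
  have "ennreal (1 - \<alpha>) * transport_dist nrm (CVaR \<alpha>) P0 P \<le> transport_dist nrm mean P0 P"
    unfolding transport_dist_def
  proof (rule INF_greatest)
    fix Q assume Q: "Q \<in> couplings P0 P"
    then have "prob_space Q"
      by (simp add: couplings_def)
    then have "CVaR \<alpha> Q (\<lambda>(x, y). nrm (x - y)) \<le> ennreal (1 / (1 - \<alpha>)) * mean Q (\<lambda>(x, y). nrm (x - y))"
      using norm_nonneg[OF assms(1)]
      by (intro CVaR_le_mean transport_cost_measurable[OF assms(1) Q] \<alpha>) (auto split: prod.splits)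
    then have "(INF Q\<in>couplings P0 P. CVaR \<alpha> Q (\<lambda>(x, y). nrm (x - y)))
        \<le> ennreal (1 / (1 - \<alpha>)) * mean Q (\<lambda>(x, y). nrm (x - y))"
      using Q by (rule INF_lower2[rotated])
    then have "ennreal (1 - \<alpha>) * (INF Q\<in>couplings P0 P. CVaR \<alpha> Q (\<lambda>(x, y). nrm (x - y)))
        \<le> ennreal (1 - \<alpha>) * (ennreal (1 / (1 - \<alpha>)) * mean Q (\<lambda>(x, y). nrm (x - y)))"
      by (rule mult_left_mono) simp
    then show "ennreal (1 - \<alpha>) * (INF Q\<in>couplings P0 P. CVaR \<alpha> Q (\<lambda>(x, y). nrm (x - y)))
        \<le> mean Q (\<lambda>(x, y). nrm (x - y))"
      by (simp add: mult.assoc[symmetric] inv)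
  qed
  also have "\<dots> \<le> ennreal ((1 - \<alpha>) * r)"
    using P by (simp add: transport_ball_def)
  finally have "ennreal (1 / (1 - \<alpha>)) * (ennreal (1 - \<alpha>) * transport_dist nrm (CVaR \<alpha>) P0 P)
      \<le> ennreal (1 / (1 - \<alpha>)) * ennreal ((1 - \<alpha>) * r)"
    by (rule mult_left_mono) simp
  moreover have "ennreal (1 / (1 - \<alpha>)) * ennreal ((1 - \<alpha>) * r) = ennreal r"
    using \<alpha> assms(4) by (simp flip: ennreal_mult)
  ultimately have "transport_dist nrm (CVaR \<alpha>) P0 P \<le> ennreal r"
    using inv by (simp add: mult.assoc[symmetric] mult.commute)
  then show "P \<in> ball_CVaR nrm \<alpha> r P0"
    using P by (simp add: transport_ball_def)
qed

theorem theorem3: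
  fixes nrm :: "real ^ 'n \<Rightarrow> real"
    and xi :: "nat \<Rightarrow> real ^ 'n"
    and N :: nat
    and \<epsilon> \<alpha> :: real
    and l :: "real ^ 'n \<Rightarrow> real"
    and L :: ereal
  assumes "is_norm nrm"
    and "N \<ge> 1"
    and "\<epsilon> \<ge> 0"
    and "0 \<le> \<alpha>" and "\<alpha> < 1"
    and "convex_on UNIV l"
    and "L = max_subgradient_norm nrm l"
    and "L < \<infinity>"
  shows "worst_case (ball_CVaR nrm \<alpha> \<epsilon> (empirical N xi)) l =
           max (worst_case (ball_wc nrm \<epsilon> (empirical N xi)) l)
               (worst_case (ball_W nrm ((1 - \<alpha>) * \<epsilon>) (empirical N xi)) l)
       \<and> (\<forall>i\<in>{1..N}. \<exists>e. is_arg_max (\<lambda>e. l (xi i + \<epsilon> *\<^sub>R e)) (\<lambda>e. nrm e = 1) e)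
       \<and> worst_case (ball_wc nrm \<epsilon> (empirical N xi)) l =
           (\<Sum>i=1..N. SUP e\<in>{e. nrm e = 1}. ereal (l (xi i + \<epsilon> *\<^sub>R e))) / ereal (real N)
       \<and> worst_case (ball_W nrm ((1 - \<alpha>) * \<epsilon>) (empirical N xi)) l =
           ereal ((\<Sum>i=1..N. l (xi i)) / real N) + L * ereal ((1 - \<alpha>) * \<epsilon>)"
proof -
  note nrm = assms(1) and N = assms(2) and \<epsilon> = assms(3) and \<alpha> = assms(4,5) and l = assms(6)
  obtain K where K: "max_subgradient_norm nrm l = ereal K" "0 \<le> K"
    using max_subgradient_norm_ereal[OF nrm l] assms(7,8) by metis
  have r: "0 \<le> (1 - \<alpha>) * \<epsilon>"
    using \<epsilon> \<alpha> by simp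
  let ?wc = "worst_case (ball_wc nrm \<epsilon> (empirical N xi)) l"
  let ?W = "worst_case (ball_W nrm ((1 - \<alpha>) * \<epsilon>) (empirical N xi)) l"
  let ?C = "worst_case (ball_CVaR nrm \<alpha> \<epsilon> (empirical N xi)) l"
  have wc: "?wc = ereal ((\<Sum>i=1..N. sphere_max nrm l (xi i) \<epsilon>) / real N)"
    unfolding worst_case_def
    by (intro antisym SUP_least expect_le_of_ball_wc[OF nrm l K N \<epsilon>]
        worst_case_ball_wc_ge[OF nrm l K N \<epsilon>, unfolded worst_case_def])
  have W: "?W = ereal ((\<Sum>i=1..N. l (xi i)) / real N + K * ((1 - \<alpha>) * \<epsilon>))"
    unfolding worst_case_def
    by (intro antisym SUP_least expect_le_of_ball_W[OF nrm l K N r]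
        worst_case_ball_W_ge[OF nrm l K N r, unfolded worst_case_def])
  have "?C \<le> max ?wc ?W"
    using expect_le_of_ball_CVaR[OF nrm l K N \<epsilon> \<alpha>]
    by (simp add: wc W ereal_max worst_case_def[of "ball_CVaR _ _ _ _"] SUP_least)
  moreover have "?wc \<le> ?C" "?W \<le> ?C"
    unfolding worst_case_def
    by (intro SUP_subset_mono ball_wc_subset_ball_CVaR ball_W_subset_ball_CVaR nrm \<alpha> \<epsilon> order_refl)+
  ultimately have "?C = max ?wc ?W"
    by (intro antisym) auto
  moreover have "\<forall>i\<in>{1..N}. \<exists>e. is_arg_max (\<lambda>e. l (xi i + \<epsilon> *\<^sub>R e)) (\<lambda>e. nrm e = 1) e"
  proof
    fix i
    obtain e where "nrm e = 1" "\<And>e'. nrm e' = 1 \<Longrightarrow> l (xi i + \<epsilon> *\<^sub>R e') \<le> l (xi i + \<epsilon> *\<^sub>R e)"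
      using sphere_max_attained[OF nrm l] by blast
    then have "is_arg_max (\<lambda>e. l (xi i + \<epsilon> *\<^sub>R e)) (\<lambda>e. nrm e = 1) e"
      by (simp add: is_arg_max_linorder)
    then show "\<exists>e. is_arg_max (\<lambda>e. l (xi i + \<epsilon> *\<^sub>R e)) (\<lambda>e. nrm e = 1) e" ..
  qed
  moreover have "?wc = (\<Sum>i=1..N. SUP e\<in>{e. nrm e = 1}. ereal (l (xi i + \<epsilon> *\<^sub>R e))) / ereal (real N)"
  proof -
    have "(SUP e\<in>{e. nrm e = 1}. ereal (l (xi i + \<epsilon> *\<^sub>R e))) = ereal (sphere_max nrm l (xi i) \<epsilon>)" for i
    proof -
      obtain e where e: "nrm e = 1" "sphere_max nrm l (xi i) \<epsilon> = l (xi i + \<epsilon> *\<^sub>R e)"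
        using sphere_max_attained[OF nrm l] by blast
      show ?thesis
        using le_sphere_max[OF nrm l, where x = "xi i" and t = \<epsilon>] e by (intro antisym SUP_least SUP_upper2[of e]) auto
    qed
    then show ?thesis
      using N by (simp add: wc)
  qed
  moreover have "?W = ereal ((\<Sum>i=1..N. l (xi i)) / real N) + L * ereal ((1 - \<alpha>) * \<epsilon>)"
    by (simp add: W assms(7) K)
  ultimately show ?thesis
    by blast
qed

end
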